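(* Suppose that the undirected graph $\mathcal G$ is connected. A matrix $X^*\in\mathbb R^{r\times p}$ is a least squares solution to the matrix equation $AXB=F$ if and only if there exist $Y_{\rm E}^*\in\mathbb R^{nr\times q}$ and $Z^*\in\mathbb R^{nr\times q}$ such that $(X^*,Y_{\rm E}^*,Z^* )$ is a solution to the optimization problem $$\min_{X,Y_{\rm E},Z}\ \sum_{i=1}^n\|A_{vi}Y_i-F_{vi}\|_{\rm F}^2\quad\text{s.t.}\quad \frac1nY_i-X_{li}B_{vi}+\sum_{j=1}^n a_{i,j}(Z_i-Z_j)=0_{r\times q},\ \ Y_i=Y_j,\ \ i,j\in\{1,\ldots,n\}.$$
   Context: $A\in\mathbb R^{m\times r}$, $B\in\mathbb R^{p\times q}$, $F\in\mathbb R^{m\times q}$ are partitioned (Row-Row-Row structure) as $A=[A_{v1}^{\rm T},\ldots,A_{vn}^{\rm T}]^{\rm T}$, $B=[B_{v1}^{\rm T},\ldots,B_{vn}^{\rm T}]^{\rm T}$, $F=[F_{v1}^{\rm T},\ldots,F_{vn}^{\rm T}]^{\rm T}$ with $A_{vi}\in\mathbb R^{m_i\times r}$, $B_{vi}\in\mathbb R^{p_i\times q}$, $F_{vi}\in\mathbb R^{m_i\times q}$, $\sum_i m_i=m$, $\sum_i p_i=p$. The variables are $X=[X_{l1},\ldots,X_{ln}]\in\mathbb R^{r\times p}$ with $X_{li}\in\mathbb R^{r\times p_i}$, $Y_{\rm E}=[Y_1^{\rm T},\ldots,Y_n^{\rm T}]^{\rm T}\in\mathbb R^{nr\times q}$ and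 $Z=[Z_1^{\rm T},\ldots,Z_n^{\rm T}]^{\rm T}\in\mathbb R^{nr\times q}$ with $Y_i,Z_i\in\mathbb R^{r\times q}$. $\mathcal G$ is an undirected graph on $\{1,\ldots,n\}$ with symmetric adjacency matrix $[a_{i,j}]$, $a_{i,j}=a_{j,i}>0$ if $\{j,i\}$ is an edge and $a_{i,j}=0$ otherwise. A least squares solution to $AXB=F$ is a minimizer of $\|AXB-F\|_{\rm F}^2$ over $X\in\mathbb R^{r\times p}$; $\|\cdot\|_{\rm F}$ is the Frobenius norm. *)

theory Defs
  imports
    Complex_Main
    "Jordan_Normal_Form.Matrix"
    "Jordan_Normal_Form.DL_Submatrix"
    "Graph_Theory.Digraph_Component"
begin

text \<open>
  The agents \<open>1, ..., n\<close> are numbered \<open>0, ..., n - 1\<close>, in line with the indexing of matrices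
  from 0.  A partition of the rows (or columns) of a matrix is given by the function \<open>s\<close> of
  block sizes: block \<open>i\<close> consists of the \<open>s i\<close> indices that come after those of the
  blocks \<open>0, ..., i - 1\<close>.
\<close>

definition block_indices :: "(nat \<Rightarrow> nat) \<Rightarrow> nat \<Rightarrow> nat set" where
  "block_indices s i = {(\<Sum>j<i. s j) ..< (\<Sum>j<Suc i. s j)}"

definition row_block :: "(nat \<Rightarrow> nat) \<Rightarrow> 'a mat \<Rightarrow> nat \<Rightarrow> 'a mat" where
  "row_block s M i = submatrix M (block_indices s i) UNIV"

definition col_block :: "(nat \<Rightarrow> nat) \<Rightarrow> 'a mat \<Rightarrow> nat \<Rightarrow> 'a mat" where
  "col_block s M i = submatrix M UNIV (block_indices s i)"

definition finsum_mat :: "nat \<Rightarrow> nat \<Rightarrow> ('b \<Rightarrow> 'a :: semiring_1 mat) \<Rightarrow> 'b set \<Rightarrow> 'a mat" where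
  "finsum_mat nr nc = finsum (module_mat TYPE('a) nr nc)"

definition frobenius_norm :: "real mat \<Rightarrow> real" where
  "frobenius_norm M = sqrt (\<Sum>i<dim_row M. \<Sum>j<dim_col M. (M $$ (i, j))\<^sup>2)"

text \<open>
  Undirected graphs are symmetric digraphs in the graph library, so that \<open>{j, i}\<close> is an edge
  iff the pair \<open>(j, i)\<close> is an arc.
\<close>

definition weighted_adjacency_matrix :: "nat pair_pre_digraph \<Rightarrow> nat \<Rightarrow> real mat \<Rightarrow> bool" where
  "weighted_adjacency_matrix G n W \<longleftrightarrow>
     W \<in> carrier_mat n n \<and> transpose_mat W = W \<and>
     (\<forall>i<n. \<forall>j<n. if (j, i) \<in> parcs G then W $$ (i, j) > 0 else W $$ (i, j) = 0)"

definition least_squares_solution :: "real mat \<Rightarrow> real mat \<Rightarrow> real mat \<Rightarrow> real mat \<Rightarrow> bool" where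
  "least_squares_solution A B F X \<longleftrightarrow>
     is_arg_min (\<lambda>X. (frobenius_norm (A * X * B - F))\<^sup>2)
       (\<lambda>X. X \<in> carrier_mat (dim_col A) (dim_row B)) X"

text \<open>
  The distributed problem for \<open>n\<close> agents: \<open>ms\<close> and \<open>ps\<close> are the block sizes of the rows of
  \<open>A\<close>, \<open>F\<close> and of \<open>B\<close>; \<open>Y\<close> and \<open>Z\<close> are stacked from \<open>n\<close> blocks with \<open>r\<close> rows each.
\<close>

definition distributed_objective ::
  "nat \<Rightarrow> nat \<Rightarrow> (nat \<Rightarrow> nat) \<Rightarrow> real mat \<Rightarrow> real mat \<Rightarrow> real mat \<Rightarrow> real" where
  "distributed_objective n r ms A F Y =
     (\<Sum>i<n. (frobenius_norm (row_block ms A i * row_block (\<lambda>_. r) Y i - row_block ms F i))\<^sup>2)"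

definition distributed_feasible ::
  "nat \<Rightarrow> nat \<Rightarrow> nat \<Rightarrow> nat \<Rightarrow> (nat \<Rightarrow> nat) \<Rightarrow> real mat \<Rightarrow> real mat \<Rightarrow>
     real mat \<times> real mat \<times> real mat \<Rightarrow> bool" where
  "distributed_feasible n r p q ps B W = (\<lambda>(X, Y, Z).
     X \<in> carrier_mat r p \<and> Y \<in> carrier_mat (n * r) q \<and> Z \<in> carrier_mat (n * r) q \<and>
     (\<forall>i<n. (1 / real n) \<cdot>\<^sub>m row_block (\<lambda>_. r) Y i - col_block ps X i * row_block ps B i
        + finsum_mat r q
            (\<lambda>j. W $$ (i, j) \<cdot>\<^sub>m (row_block (\<lambda>_. r) Z i - row_block (\<lambda>_. r) Z j)) {..<n}
        = 0\<^sub>m r q) \<and>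
     (\<forall>i<n. \<forall>j<n. row_block (\<lambda>_. r) Y i = row_block (\<lambda>_. r) Y j))"

definition distributed_solution ::
  "nat \<Rightarrow> nat \<Rightarrow> nat \<Rightarrow> nat \<Rightarrow> (nat \<Rightarrow> nat) \<Rightarrow> (nat \<Rightarrow> nat) \<Rightarrow> real mat \<Rightarrow> real mat \<Rightarrow> real mat \<Rightarrow>
     real mat \<Rightarrow> real mat \<times> real mat \<times> real mat \<Rightarrow> bool" where
  "distributed_solution n r p q ms ps A B F W =
     is_arg_min (\<lambda>(X, Y, Z). distributed_objective n r ms A F Y)
       (distributed_feasible n r p q ps B W)"

lemma pick_atLeastLessThan:
  assumes "k < b - a"
  shows "pick {a..<b} k = a + k"
proof -
  have "{x \<in> {a..<b}. x < a + k} = {a..<a + k}" using assms by auto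
  then show ?thesis using pick_card_in_set[of "a + k" "{a..<b}"] assms by simp
qed

lemma block_indices_eq: "block_indices s i = {(\<Sum>j<i. s j) ..< (\<Sum>j<i. s j) + s i}"
  by (simp add: block_indices_def)

lemma row_block_eq:
  assumes "(\<Sum>j<Suc i. s j) \<le> dim_row M"
  shows "row_block s M i = mat (s i) (dim_col M) (\<lambda>(k, l). M $$ ((\<Sum>j<i. s j) + k, l))"
proof -
  have "{x. x < dim_row M \<and> x \<in> block_indices s i} = block_indices s i"
    using assms by (auto simp: block_indices_eq)
  then have "card {x. x < dim_row M \<and> x \<in> block_indices s i} = s i"
    by (simp add: block_indices_eq)
  moreover have "pick (block_indices s i) k = (\<Sum>j<i. s j) + k" if "k < s i" for k
    unfolding block_indices_eq using that by (intro pick_atLeastLessThan) simp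
  ultimately show ?thesis
    unfolding row_block_def submatrix_def by (intro cong_mat) (simp_all add: pick_UNIV)
qed

lemma col_block_eq:
  assumes "(\<Sum>j<Suc i. s j) \<le> dim_col M"
  shows "col_block s M i = mat (dim_row M) (s i) (\<lambda>(k, l). M $$ (k, (\<Sum>j<i. s j) + l))"
proof -
  have "{x. x < dim_col M \<and> x \<in> block_indices s i} = block_indices s i"
    using assms by (auto simp: block_indices_eq)
  then have "card {x. x < dim_col M \<and> x \<in> block_indices s i} = s i"
    by (simp add: block_indices_eq)
  moreover have "pick (block_indices s i) k = (\<Sum>j<i. s j) + k" if "k < s i" for k
    unfolding block_indices_eq using that by (intro pick_atLeastLessThan) simp
  ultimately show ?thesis
    unfolding col_block_def submatrix_def by (intro cong_mat) (simp_all add: pick_UNIV)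
qed

lemma finsum_mat_eq:
  fixes f :: "'b \<Rightarrow> 'a :: comm_ring_1 mat"
  assumes "finite S" and "\<And>x. x \<in> S \<Longrightarrow> f x \<in> carrier_mat nr nc"
  shows "finsum_mat nr nc f S = mat nr nc (\<lambda>(k, l). \<Sum>x\<in>S. f x $$ (k, l))"
proof -
  interpret abelian_group "module_mat TYPE('a) nr nc" by (rule abelian_group_mat)
  show ?thesis using assms
  proof (induction S rule: finite_induct)
    case empty
    show ?case unfolding finsum_mat_def finsum_empty module_mat_simps by (rule eq_matI) simp_all
  next
    case (insert x S)
    have "f \<in> S \<rightarrow> carrier (module_mat TYPE('a) nr nc)" "f x \<in> carrier (module_mat TYPE('a) nr nc)"
      using insert.prems by (auto simp only: module_mat_simps Pi_I insert_iff)
    from finsum_insert[OF insert.hyps this]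
    have step: "finsum_mat nr nc f (insert x S) = f x + finsum_mat nr nc f S"
      unfolding finsum_mat_def module_mat_simps .
    have IH: "finsum_mat nr nc f S = mat nr nc (\<lambda>(k, l). \<Sum>x\<in>S. f x $$ (k, l))"
      by (rule insert.IH) (rule insert.prems, rule insertI2)
    show ?case unfolding step IH by (rule eq_matI) (use insert.hyps in simp_all)
  qed
qed

end

(*
  Summing the coupling constraints over the agents annihilates the terms in Z, because the weights
  are symmetric; as the Y_i are equal, each of them is then X B, so that the distributed objective
  of a feasible point is the squared residual of A X B = F.  Conversely, given X, put Y_i = X B.
  For each entry the constraints then read L z = b with the graph Laplacian L and a vector b of
  entry sum 0.  Connectedness makes L + J invertible, where J is the all-ones matrix, and the
  solution of (L + J) z = b satisfies J z = 0, since the columns of L sum to 0.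
*)
theory Submission
  imports Defs "Jordan_Normal_Form.Determinant"
begin

section \<open>Solvability of weighted Laplacian systems\<close>

lemma det_nonzero_solvable:
  fixes M :: "'a :: field mat"
  assumes M: "M \<in> carrier_mat n n" and "det M \<noteq> 0" and b: "b \<in> carrier_vec n"
  shows "\<exists>x \<in> carrier_vec n. M *\<^sub>v x = b"
proof -
  from det_non_zero_imp_unit[OF M \<open>det M \<noteq> 0\<close>, of "()"]
  obtain N where N: "N \<in> carrier_mat n n" "M * N = 1\<^sub>m n"
    by (auto simp: Units_def ring_mat_def)
  have "M *\<^sub>v (N *\<^sub>v b) = b"
    using assoc_mult_mat_vec[OF M N(1) b] N(2) b by simp
  then show ?thesis using N(1) b by (intro bexI[of _ "N *\<^sub>v b"]) simp_all
qed

text \<open>Exchanging the names of \<open>i\<close> and \<open>j\<close> turns the double sum into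
  its negative. In matrix terms, the columns of the Laplacian sum to 0.\<close>

lemma sum_laplacian_eq_0:
  fixes a :: "nat \<Rightarrow> nat \<Rightarrow> real"
  assumes sym: "\<And>i j. i < n \<Longrightarrow> j < n \<Longrightarrow> a i j = a j i"
  shows "(\<Sum>i<n. \<Sum>j<n. a i j * (x i - x j)) = 0"
proof -
  have "(\<Sum>i<n. \<Sum>j<n. a i j * x i) = (\<Sum>j<n. \<Sum>i<n. a i j * x i)"
    by (rule sum.swap)
  also have "\<dots> = (\<Sum>i<n. \<Sum>j<n. a i j * x j)"
    by (intro sum.cong refl) (simp add: sym)
  finally show ?thesis by (simp add: right_diff_distrib sum_subtractf)
qed

text \<open>Adding each term to its mirror image under the exchange of \<open>i\<close> and
  \<open>j\<close> completes the square, hence the factor 2. For nonnegative weights this shows that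
  a kernel vector of the Laplacian is constant across every edge.\<close>

lemma laplacian_quadratic_form:
  fixes a :: "nat \<Rightarrow> nat \<Rightarrow> real"
  assumes sym: "\<And>i j. i < n \<Longrightarrow> j < n \<Longrightarrow> a i j = a j i"
  shows "2 * (\<Sum>i<n. x i * (\<Sum>j<n. a i j * (x i - x j))) = (\<Sum>i<n. \<Sum>j<n. a i j * (x i - x j)\<^sup>2)"
proof -
  let ?S = "\<Sum>i<n. \<Sum>j<n. a i j * (x i * (x i - x j))"
  have "?S = (\<Sum>j<n. \<Sum>i<n. a i j * (x i * (x i - x j)))"
    by (rule sum.swap)
  also have "\<dots> = (\<Sum>i<n. \<Sum>j<n. a i j * (x j * (x j - x i)))"
    by (intro sum.cong refl) (simp add: sym)
  finally have "2 * ?S = ?S + (\<Sum>i<n. \<Sum>j<n. a i j * (x j * (x j - x i)))"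
    by simp
  also have "\<dots> = (\<Sum>i<n. \<Sum>j<n. a i j * (x i - x j)\<^sup>2)"
    by (simp add: sum.distrib[symmetric] power2_eq_square algebra_simps)
  finally show ?thesis
    by (simp add: sum_distrib_left mult.left_commute)
qed

text \<open>Entry sum 0 is necessary for \<open>b\<close> by \<open>sum_laplacian_eq_0\<close>;
  reachability along positive weights makes it sufficient, as only constant vectors are then in the
  kernel of the Laplacian.\<close>

lemma laplacian_solvable:
  fixes a :: "nat \<Rightarrow> nat \<Rightarrow> real"
  assumes sym: "\<And>i j. i < n \<Longrightarrow> j < n \<Longrightarrow> a i j = a j i"
    and nonneg: "\<And>i j. i < n \<Longrightarrow> j < n \<Longrightarrow> 0 \<le> a i j"
    and conn: "\<And>i j. i < n \<Longrightarrow> j < n \<Longrightarrow> (i, j) \<in> rtrancl_on {..<n} {(i, j). 0 < a i j}"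
    and b: "(\<Sum>i<n. b i) = 0"
  shows "\<exists>z. \<forall>i<n. (\<Sum>j<n. a i j * (z i - z j)) = b i"
proof -
  let ?L = "\<lambda>x i. \<Sum>j<n. a i j * (x i - x j)"
  \<comment> \<open>This is L + J. A loop weight \<open>a i i\<close> occurs in the degree and is
    subtracted again, so it has no effect.\<close>
  define M where "M = mat n n (\<lambda>(i, j). (if i = j then \<Sum>k<n. a i k else 0) - a i j + 1)"
  have M: "M \<in> carrier_mat n n" by (simp add: M_def)
  have Mv: "(M *\<^sub>v v) $ i = ?L (($) v) i + (\<Sum>j<n. v $ j)"
    if "v \<in> carrier_vec n" "i < n" for v i
  proof -
    have "(M *\<^sub>v v) $ i = (\<Sum>j<n. ((if i = j then \<Sum>k<n. a i k else 0) - a i j + 1) * v $ j)"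
      using that by (simp add: M_def scalar_prod_def atLeast0LessThan)
    also have "\<dots> = (\<Sum>j<n. (if i = j then (\<Sum>k<n. a i k) * v $ j else 0) - a i j * v $ j + v $ j)"
      by (intro sum.cong) (auto simp: algebra_simps)
    also have "\<dots> = ?L (($) v) i + (\<Sum>j<n. v $ j)"
      using that by (simp add: sum.distrib sum_subtractf right_diff_distrib sum_distrib_right)
    finally show ?thesis .
  qed
  \<comment> \<open>Summing the rows of \<open>M\<close> removes L and leaves n J, so the entry sum
    of \<open>v\<close> can be read off from \<open>M *\<^sub>v v\<close>.\<close>
  have sum_Mv: "(\<Sum>i<n. (M *\<^sub>v v) $ i) = real n * (\<Sum>j<n. v $ j)"
    if "v \<in> carrier_vec n" for v
    using that sum_laplacian_eq_0[of n a "($) v", OF sym] by (simp add: Mv sum.distrib)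
  have "det M \<noteq> 0"
  proof
    assume "det M = 0"
    then obtain v where v: "v \<in> carrier_vec n" "v \<noteq> 0\<^sub>v n" "M *\<^sub>v v = 0\<^sub>v n"
      using det_0_iff_vec_prod_zero[OF M] by blast
    then have "real n * (\<Sum>j<n. v $ j) = 0"
      using sum_Mv[OF v(1)] by simp
    then have s0: "(\<Sum>j<n. v $ j) = 0" by (cases "n = 0") auto
    then have "?L (($) v) i = 0" if "i < n" for i
      using Mv[OF v(1) that] v(3) that by simp
    then have "(\<Sum>i<n. \<Sum>j<n. a i j * (v $ i - v $ j)\<^sup>2) = 0"
      using laplacian_quadratic_form[of n a "($) v", OF sym] by simp
    then have "\<forall>i<n. (\<Sum>j<n. a i j * (v $ i - v $ j)\<^sup>2) = 0"
      by (subst (asm) sum_nonneg_eq_0_iff) (auto intro!: sum_nonneg simp: nonneg)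
    then have "a i j * (v $ i - v $ j)\<^sup>2 = 0" if "i < n" "j < n" for i j
      using that sum_nonneg_0[of "{..<n}" "\<lambda>j. a i j * (v $ i - v $ j)\<^sup>2" j] nonneg by simp
    \<comment> \<open>The quadratic form vanishes and its terms are nonnegative, so each term is 0,
      and a positive weight forces equal entries.\<close>
    then have step: "v $ i = v $ j" if "i < n" "j < n" "0 < a i j" for i j
      using that by force
    have const: "v $ i = v $ j" if "i < n" "j < n" for i j
      using conn[OF that] by induction (auto dest: step)
    \<comment> \<open>A constant vector with entry sum 0 is zero.\<close>
    have "v $ i = 0" if "i < n" for i
    proof -
      have "(\<Sum>j<n. v $ j) = real n * v $ i"
        using const[OF _ that] by simp
      then show ?thesis using s0 that by simp
    qed
    then show False using v by auto
  qed
  then obtain z where z: "z \<in> carrier_vec n" "M *\<^sub>v z = vec n b"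
    using det_nonzero_solvable[OF M, of "vec n b"] by auto
  then have "real n * (\<Sum>j<n. z $ j) = 0"
    using sum_Mv[OF z(1)] b by simp
  then have "(\<Sum>j<n. z $ j) = 0" by (cases "n = 0") auto
  then have "\<forall>i<n. ?L (($) z) i = b i"
    using Mv[OF z(1)] z(2) by simp
  then show ?thesis by blast
qed

section \<open>Products and Frobenius norms of partitioned matrices\<close>

lemma sum_blocks:
  fixes h :: "nat \<Rightarrow> 'a :: comm_monoid_add" and s :: "nat \<Rightarrow> nat"
  shows "(\<Sum>k<(\<Sum>i<n. s i). h k) = (\<Sum>i<n. \<Sum>t<s i. h ((\<Sum>j<i. s j) + t))"
proof (induction n)
  case (Suc n)
  have "(\<Sum>k<a + b. h k) = (\<Sum>k<a. h k) + (\<Sum>t<b. h (a + t))" for a b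
    by (induct b) (simp_all add: add.assoc)
  with Suc show ?case by simp
qed simp

lemma block_end_le: "i < n \<Longrightarrow> (\<Sum>j<Suc i. s j) \<le> (\<Sum>j<n. s j)" for s :: "nat \<Rightarrow> nat"
  by (rule sum_mono2) auto

lemma block_index_less: "i < n \<Longrightarrow> t < s i \<Longrightarrow> (\<Sum>j<i. s j) + t < (\<Sum>j<n. s j)"
  for s :: "nat \<Rightarrow> nat"
  using block_end_le[of i n s] by simp

lemma frobenius_norm_sq: "(frobenius_norm M)\<^sup>2 = (\<Sum>i<dim_row M. \<Sum>j<dim_col M. (M $$ (i, j))\<^sup>2)"
  unfolding frobenius_norm_def by (intro real_sqrt_pow2 sum_nonneg) simp

text \<open>A row of a product depends only on the same row of the left factor. Hence, when all
  agents hold the same \<open>V\<close>, their local residuals are the row blocks of the global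
  one.\<close>

lemma row_block_mult_minus:
  fixes A V F :: "'a :: ring_1 mat"
  assumes "(\<Sum>j<n. s j) = m" "i < n" and A: "A \<in> carrier_mat m r" and V: "V \<in> carrier_mat r q"
    and F: "F \<in> carrier_mat m q"
  shows "row_block s A i * V - row_block s F i = row_block s (A * V - F) i"
proof -
  have le: "(\<Sum>j<Suc i. s j) \<le> m" using block_end_le[of i n s] assms by simp
  show ?thesis
    using le A V F
    by (intro eq_matI) (auto simp: row_block_eq scalar_prod_def)
qed

lemma sum_frobenius_row_block:
  assumes "(\<Sum>j<n. s j) = m" and M: "M \<in> carrier_mat m q"
  shows "(\<Sum>i<n. (frobenius_norm (row_block s M i))\<^sup>2) = (frobenius_norm M)\<^sup>2"
proof -
  have "(frobenius_norm (row_block s M i))\<^sup>2 = (\<Sum>t<s i. \<Sum>l<q. (M $$ ((\<Sum>j<i. s j) + t, l))\<^sup>2)"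
    if "i < n" for i
    using block_end_le[OF that, of s] assms by (simp add: frobenius_norm_sq row_block_eq)
  then have "(\<Sum>i<n. (frobenius_norm (row_block s M i))\<^sup>2)
      = (\<Sum>i<n. \<Sum>t<s i. \<Sum>l<q. (M $$ ((\<Sum>j<i. s j) + t, l))\<^sup>2)"
    by simp
  also have "\<dots> = (\<Sum>k<m. \<Sum>l<q. (M $$ (k, l))\<^sup>2)"
    using sum_blocks[where s = s and n = n and h = "\<lambda>k. \<Sum>l<q. (M $$ (k, l))\<^sup>2"] assms(1) by simp
  finally show ?thesis using M by (simp add: frobenius_norm_sq)
qed

text \<open>The inner index of the product is summed block by block. The entrywise form fits the
  scalar equations into which the coupling constraints are split.\<close>

lemma sum_col_block_mult_row_block:
  fixes X B :: "'a :: semiring_1 mat"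
  assumes "(\<Sum>j<n. s j) = p" and X: "X \<in> carrier_mat r p" and B: "B \<in> carrier_mat p q"
    and "k < r" "l < q"
  shows "(\<Sum>i<n. (col_block s X i * row_block s B i) $$ (k, l)) = (X * B) $$ (k, l)"
proof -
  have "(col_block s X i * row_block s B i) $$ (k, l)
      = (\<Sum>t<s i. X $$ (k, (\<Sum>j<i. s j) + t) * B $$ ((\<Sum>j<i. s j) + t, l))" if "i < n" for i
    using block_end_le[OF that, of s] assms
    by (simp add: row_block_eq col_block_eq scalar_prod_def atLeast0LessThan)
  then have "(\<Sum>i<n. (col_block s X i * row_block s B i) $$ (k, l))
      = (\<Sum>i<n. \<Sum>t<s i. X $$ (k, (\<Sum>j<i. s j) + t) * B $$ ((\<Sum>j<i. s j) + t, l))"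
    by simp
  also have "\<dots> = (\<Sum>u<p. X $$ (k, u) * B $$ (u, l))"
    using sum_blocks[where s = s and n = n and h = "\<lambda>u. X $$ (k, u) * B $$ (u, l)"] assms(1) by simp
  also have "\<dots> = (X * B) $$ (k, l)"
    using assms by (simp add: scalar_prod_def atLeast0LessThan)
  finally show ?thesis .
qed

lemma col_block_mult_row_block_carrier:
  assumes "(\<Sum>j<n. s j) = p" "i < n" "X \<in> carrier_mat r p" "B \<in> carrier_mat p q"
  shows "col_block s X i * row_block s B i \<in> carrier_mat r q"
  using block_end_le[of i n s] assms
  by (intro mult_carrier_mat[of _ _ "s i"]) (simp_all add: row_block_eq col_block_eq)

section \<open>Coupling constraints and feasible points\<close>

lemma row_block_uniform:
  assumes "Y \<in> carrier_mat (n * r) q" "i < n"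
  shows "row_block (\<lambda>_. r) Y i = mat r q (\<lambda>(k, l). Y $$ (i * r + k, l))"
  using block_end_le[OF assms(2), of "\<lambda>_. r"] assms(1) by (simp add: row_block_eq mult.commute)

text \<open>The matrix constraint decouples over the entries \<open>(k, l)\<close>. For a fixed
  entry, the values of \<open>Z\<close> in the \<open>n\<close> blocks form a vector on the vertices
  of the graph, to which row \<open>i\<close> of the Laplacian is applied.\<close>

lemma coupling_iff:
  fixes X B W Y Z :: "real mat"
  assumes "(\<Sum>j<n. s j) = p" "i < n" "X \<in> carrier_mat r p" "B \<in> carrier_mat p q"
    and Y: "Y \<in> carrier_mat (n * r) q" and Z: "Z \<in> carrier_mat (n * r) q"
  shows "(1 / real n) \<cdot>\<^sub>m row_block (\<lambda>_. r) Y i - col_block s X i * row_block s B i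
        + finsum_mat r q
            (\<lambda>j. W $$ (i, j) \<cdot>\<^sub>m (row_block (\<lambda>_. r) Z i - row_block (\<lambda>_. r) Z j)) {..<n}
        = 0\<^sub>m r q \<longleftrightarrow>
    (\<forall>k<r. \<forall>l<q. Y $$ (i * r + k, l) / real n - (col_block s X i * row_block s B i) $$ (k, l)
        + (\<Sum>j<n. W $$ (i, j) * (Z $$ (i * r + k, l) - Z $$ (j * r + k, l))) = 0)"
    (is "?S = _ \<longleftrightarrow> (\<forall>k<r. \<forall>l<q. ?e k l = 0)")
proof -
  let ?P = "col_block s X i * row_block s B i"
  have P: "?P \<in> carrier_mat r q"
    using assms by (intro col_block_mult_row_block_carrier)
  have f: "finsum_mat r q
        (\<lambda>j. W $$ (i, j) \<cdot>\<^sub>m (row_block (\<lambda>_. r) Z i - row_block (\<lambda>_. r) Z j)) {..<n}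
      = mat r q (\<lambda>(k, l). \<Sum>j<n. W $$ (i, j) * (Z $$ (i * r + k, l) - Z $$ (j * r + k, l)))"
    by (subst finsum_mat_eq)
      (use \<open>i < n\<close> Z in \<open>auto simp: row_block_uniform intro!: eq_matI\<close>)
  have "(1 / real n) \<cdot>\<^sub>m row_block (\<lambda>_. r) Y i - P + mat r q g
      = mat r q (\<lambda>(k, l). Y $$ (i * r + k, l) / real n - P $$ (k, l) + g (k, l))"
    if "P \<in> carrier_mat r q" for P g
    using that \<open>i < n\<close> Y by (intro eq_matI) (auto simp: row_block_uniform)
  then have "?S = mat r q (\<lambda>(k, l). ?e k l)"
    unfolding f using P by simp
  then show ?thesis by (auto simp: mat_eq_iff)
qed

lemma feasible_row_block:
  assumes "(\<Sum>j<n. s j) = p" "B \<in> carrier_mat p q" and "0 < n"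
    and sym: "\<And>i j. i < n \<Longrightarrow> j < n \<Longrightarrow> W $$ (i, j) = W $$ (j, i)"
    and feas: "distributed_feasible n r p q s B W (X, Y, Z)" and "i < n"
  shows "row_block (\<lambda>_. r) Y i = X * B"
proof -
  from feas have X: "X \<in> carrier_mat r p" and Y: "Y \<in> carrier_mat (n * r) q"
    and Z: "Z \<in> carrier_mat (n * r) q"
    and eq: "\<And>i j. i < n \<Longrightarrow> j < n \<Longrightarrow> row_block (\<lambda>_. r) Y i = row_block (\<lambda>_. r) Y j"
    unfolding distributed_feasible_def prod.case by blast+
  have cpl: "Y $$ (i * r + k, l) / real n - (col_block s X i * row_block s B i) $$ (k, l)
        + (\<Sum>j<n. W $$ (i, j) * (Z $$ (i * r + k, l) - Z $$ (j * r + k, l))) = 0"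
    if "i < n" "k < r" "l < q" for i k l
    using feas[unfolded distributed_feasible_def prod.case] that
      coupling_iff[OF assms(1) \<open>i < n\<close> X assms(2) Y Z, THEN iffD1]
    by blast
  have Yj: "Y $$ (j * r + k, l) = Y $$ (i * r + k, l)" if "j < n" "k < r" "l < q" for j k l
    using eq[OF that(1) \<open>i < n\<close>] that \<open>i < n\<close> Y by (auto simp: row_block_uniform mat_eq_iff)
  have "Y $$ (i * r + k, l) = (X * B) $$ (k, l)" if kl: "k < r" "l < q" for k l
  proof -
    \<comment> \<open>The constraints of all agents are added up at one entry; the sum over the
      blocks of \<open>Z\<close> is then a full Laplacian sum and vanishes.\<close>
    have "0 = (\<Sum>j<n. Y $$ (j * r + k, l) / real n
        - (col_block s X j * row_block s B j) $$ (k, l)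
        + (\<Sum>h<n. W $$ (j, h) * (Z $$ (j * r + k, l) - Z $$ (h * r + k, l))))"
      using cpl kl by simp
    also have "\<dots> = (\<Sum>j<n. Y $$ (j * r + k, l) / real n) - (X * B) $$ (k, l)"
      using sum_laplacian_eq_0[where a = "\<lambda>i j. W $$ (i, j)" and n = n
          and x = "\<lambda>i. Z $$ (i * r + k, l)", OF sym]
        sum_col_block_mult_row_block[OF assms(1) X assms(2) kl]
      by (simp add: sum.distrib sum_subtractf)
    \<comment> \<open>The weight 1/n makes the \<open>n\<close> equal blocks of \<open>Y\<close>
      count as one.\<close>
    also have "(\<Sum>j<n. Y $$ (j * r + k, l) / real n) = Y $$ (i * r + k, l)"
      using \<open>0 < n\<close> by (simp add: Yj kl)
    finally show ?thesis by simp
  qed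
  then show ?thesis
    using X assms(2) Y \<open>i < n\<close> by (intro eq_matI) (auto simp: row_block_uniform)
qed

text \<open>The constraints do not restrict \<open>X\<close>: with each block of \<open>Y\<close>
  set to \<open>X * B\<close>, what remains is one Laplacian system for \<open>Z\<close> per
  entry.\<close>

lemma feasible_exists:
  assumes "(\<Sum>j<n. s j) = p" and B: "B \<in> carrier_mat p q" and "0 < n"
    and sym: "\<And>i j. i < n \<Longrightarrow> j < n \<Longrightarrow> W $$ (i, j) = W $$ (j, i)"
    and nonneg: "\<And>i j. i < n \<Longrightarrow> j < n \<Longrightarrow> 0 \<le> W $$ (i, j)"
    and conn: "\<And>i j. i < n \<Longrightarrow> j < n \<Longrightarrow>
      (i, j) \<in> rtrancl_on {..<n} {(i, j). 0 < W $$ (i, j)}"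
    and X: "X \<in> carrier_mat r p"
  shows "\<exists>Y Z. distributed_feasible n r p q s B W (X, Y, Z)"
proof -
  let ?P = "\<lambda>i. col_block s X i * row_block s B i"
  \<comment> \<open>The deviation of the local product of agent \<open>i\<close> from the average of
    all local products; such deviations sum to 0.\<close>
  let ?b = "\<lambda>k l i. ?P i $$ (k, l) - (X * B) $$ (k, l) / real n"
  have "\<exists>z. \<forall>i<n. (\<Sum>j<n. W $$ (i, j) * (z i - z j)) = ?b k l i" if "k < r" "l < q" for k l
    using sum_col_block_mult_row_block[OF assms(1) X B that] \<open>0 < n\<close>
    by (intro laplacian_solvable sym nonneg conn) (simp_all add: sum_subtractf)
  then obtain z where z: "\<And>k l i. k < r \<Longrightarrow> l < q \<Longrightarrow> i < n \<Longrightarrow>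
      (\<Sum>j<n. W $$ (i, j) * (z k l i - z k l j)) = ?b k l i"
    by (atomize_elim, intro choice_iff[THEN iffD1] allI) auto
  \<comment> \<open>Row \<open>u\<close> is row \<open>u mod r\<close> of block
    \<open>u div r\<close>. \<open>Y\<close> stacks \<open>n\<close> copies of \<open>X * B\<close>,
    while \<open>Z\<close> collects the solutions of the separate systems.\<close>
  define Y where "Y = mat (n * r) q (\<lambda>(u, l). (X * B) $$ (u mod r, l))"
  define Z where "Z = mat (n * r) q (\<lambda>(u, l). z (u mod r) l (u div r))"
  have less: "i * r + k < n * r" if "i < n" "k < r" for i k
    using block_index_less[of i n k "\<lambda>_. r"] that by (simp add: mult.commute)
  have Y: "Y \<in> carrier_mat (n * r) q" and Z: "Z \<in> carrier_mat (n * r) q"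
    by (simp_all add: Y_def Z_def)
  have Yi: "Y $$ (i * r + k, l) = (X * B) $$ (k, l)" if "i < n" "k < r" "l < q" for i k l
    using that less by (simp add: Y_def)
  have Zi: "Z $$ (i * r + k, l) = z k l i" if "i < n" "k < r" "l < q" for i k l
    using that less by (simp add: Z_def)
  have "\<forall>i<n. \<forall>j<n. row_block (\<lambda>_. r) Y i = row_block (\<lambda>_. r) Y j"
    using Y by (auto simp: row_block_uniform Yi intro!: cong_mat)
  moreover have "(1 / real n) \<cdot>\<^sub>m row_block (\<lambda>_. r) Y i - ?P i + finsum_mat r q
      (\<lambda>j. W $$ (i, j) \<cdot>\<^sub>m (row_block (\<lambda>_. r) Z i - row_block (\<lambda>_. r) Z j)) {..<n} = 0\<^sub>m r q"
    if "i < n" for i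
    using that z by (subst coupling_iff[OF assms(1) that X B Y Z]) (simp add: Yi Zi)
  ultimately have "distributed_feasible n r p q s B W (X, Y, Z)"
    unfolding distributed_feasible_def prod.case using X Y Z by blast
  then show ?thesis by blast
qed

section \<open>Objective values and transfer of minimizers\<close>

lemma distributed_objective_eq:
  assumes "(\<Sum>i<n. ms i) = m" and A: "A \<in> carrier_mat m r" and V: "V \<in> carrier_mat r q"
    and F: "F \<in> carrier_mat m q"
    and Y: "\<And>i. i < n \<Longrightarrow> row_block (\<lambda>_. r) Y i = V"
  shows "distributed_objective n r ms A F Y = (frobenius_norm (A * V - F))\<^sup>2"
proof -
  have "distributed_objective n r ms A F Y
      = (\<Sum>i<n. (frobenius_norm (row_block ms (A * V - F) i))\<^sup>2)"
    unfolding distributed_objective_def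
    using row_block_mult_minus[OF assms(1) _ A V F] by (simp add: Y)
  also have "\<dots> = (frobenius_norm (A * V - F))\<^sup>2"
    using A V F by (intro sum_frobenius_row_block[OF assms(1)]) auto
  finally show ?thesis .
qed

text \<open>If the objective depends on \<open>x\<close> alone and \<open>P\<close> is the
  projection of \<open>Q\<close>, the attainable values are the same in both problems. A minimizer
  \<open>x\<close> can then be paired with every \<open>u\<close> such that
  \<open>Q x u\<close>.\<close>

lemma is_arg_min_lift:
  assumes obj: "\<And>x u. Q x u \<Longrightarrow> h u = f x" and dom: "\<And>x. P x \<longleftrightarrow> (\<exists>u. Q x u)"
  shows "is_arg_min f P x \<longleftrightarrow> (\<exists>u. is_arg_min (\<lambda>(x, u). h u) (\<lambda>(x, u). Q x u) (x, u))"
proof -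
  have "is_arg_min (\<lambda>(x, u). h u) (\<lambda>(x, u). Q x u) (x, u) \<longleftrightarrow> Q x u \<and> is_arg_min f P x" for u
  proof -
    have "(\<exists>y. P y \<and> f y < f x) \<longleftrightarrow> (\<exists>y v. Q y v \<and> h v < h u)" if "Q x u"
      by (metis obj dom that)
    then show ?thesis
      unfolding is_arg_min_def using dom by auto
  qed
  then show ?thesis unfolding is_arg_min_def dom by blast
qed

theorem mainTheorem4:
  fixes n m r p q :: nat
    and ms ps :: "nat \<Rightarrow> nat"
    and A B F W X :: "real mat"
    and G :: "nat pair_pre_digraph"
  assumes "m = (\<Sum>i<n. ms i)" and "p = (\<Sum>i<n. ps i)"
    and "A \<in> carrier_mat m r" and "B \<in> carrier_mat p q" and "F \<in> carrier_mat m q"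
    and "pair_pseudo_graph G" and "pverts G = {..<n}"
    and "weighted_adjacency_matrix G n W"
    and "connected (with_proj G)"
    and "X \<in> carrier_mat r p"
  shows "least_squares_solution A B F X \<longleftrightarrow>
    (\<exists>Y \<in> carrier_mat (n * r) q. \<exists>Z \<in> carrier_mat (n * r) q.
       distributed_solution n r p q ms ps A B F W (X, Y, Z))"
proof -
  let ?Q = "\<lambda>X (Y, Z). distributed_feasible n r p q ps B W (X, Y, Z)"
  have ms: "(\<Sum>i<n. ms i) = m" and ps: "(\<Sum>i<n. ps i) = p"
    using assms(1,2) by simp_all
  \<comment> \<open>A connected digraph has a nonempty vertex set by definition.\<close>
  have "0 < n" using assms(7,9) by (auto simp: connected_conv lessThan_empty_iff bot_nat_def)
  have W: "W \<in> carrier_mat n n" "transpose_mat W = W"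
    and arc: "\<And>i j. i < n \<Longrightarrow> j < n \<Longrightarrow> (j, i) \<in> parcs G \<Longrightarrow> 0 < W $$ (i, j)"
    and no_arc: "\<And>i j. i < n \<Longrightarrow> j < n \<Longrightarrow> (j, i) \<notin> parcs G \<Longrightarrow> W $$ (i, j) = 0"
    using assms(8) unfolding weighted_adjacency_matrix_def by (auto split: if_splits)
  have sym: "W $$ (i, j) = W $$ (j, i)" if "i < n" "j < n" for i j
    using W that by (metis carrier_matD index_transpose_mat(1))
  have nonneg: "0 \<le> W $$ (i, j)" if "i < n" "j < n" for i j
    using arc[OF that] no_arc[OF that] by fastforce
  have conn: "(i, j) \<in> rtrancl_on {..<n} {(i, j). 0 < W $$ (i, j)}" if "i < n" "j < n" for i j
  proof -
    \<comment> \<open>Connectedness refers to the symmetric closure of the arcs; symmetry of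
      \<open>W\<close> gives a positive weight whichever direction is an arc.\<close>
    have "(i, j) \<in> rtrancl_on {..<n} ((parcs G)\<^sup>s)"
      using assms(7,9) that by (simp add: connected_conv)
    then show ?thesis
    proof induction
      case base
      then show ?case using that by simp
    next
      case (step y z)
      then have "0 < W $$ (y, z)"
        using arc[of y z] arc[of z y] sym[of y z] by (auto simp: symcl_def)
      with step show ?case by (auto intro: converse_rtrancl_on_into_rtrancl_on)
    qed
  qed
  \<comment> \<open>\<open>Y\<close> and \<open>Z\<close> are bundled into one auxiliary variable
    \<open>u\<close>, of which the objective reads only \<open>Y\<close>.\<close>
  have obj: "distributed_objective n r ms A F (fst u) = (frobenius_norm (A * X * B - F))\<^sup>2"
    if "?Q X u" for X u
  proof -
    obtain Y Z where u: "u = (Y, Z)" by (cases u)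
    have feas: "distributed_feasible n r p q ps B W (X, Y, Z)"
      using that u by simp
    then have X: "X \<in> carrier_mat r p" by (simp add: distributed_feasible_def)
    have "distributed_objective n r ms A F Y = (frobenius_norm (A * (X * B) - F))\<^sup>2"
      using X assms(4) feasible_row_block[OF ps assms(4) \<open>0 < n\<close> sym feas]
      by (intro distributed_objective_eq[OF ms assms(3) _ assms(5)]) auto
    then show ?thesis using X assms(3,4) u by simp
  qed
  \<comment> \<open>Feasibility contains the dimension condition on \<open>X\<close>, which gives
    one direction; the other is \<open>feasible_exists\<close>.\<close>
  have dom: "X \<in> carrier_mat (dim_col A) (dim_row B) \<longleftrightarrow> (\<exists>u. ?Q X u)" for X
    using feasible_exists[OF ps assms(4) \<open>0 < n\<close> sym nonneg conn, of X] assms(3,4)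
    by (auto simp: distributed_feasible_def)
  have "least_squares_solution A B F X \<longleftrightarrow>
      (\<exists>u. is_arg_min (\<lambda>(X, u). distributed_objective n r ms A F (fst u)) (\<lambda>(X, u). ?Q X u) (X, u))"
    unfolding least_squares_solution_def by (rule is_arg_min_lift[OF obj dom])
  also have "\<dots> \<longleftrightarrow> (\<exists>Y Z. distributed_solution n r p q ms ps A B F W (X, Y, Z))"
    by (simp add: distributed_solution_def case_prod_unfold)
  also have "\<dots> \<longleftrightarrow> (\<exists>Y \<in> carrier_mat (n * r) q. \<exists>Z \<in> carrier_mat (n * r) q.
       distributed_solution n r p q ms ps A B F W (X, Y, Z))"
    by (auto simp: distributed_solution_def distributed_feasible_def is_arg_min_def)
  finally show ?thesis .
qed

end
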